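(* Let $f\colon\mathbb{N}^2\to\mathbb{N}$ be any pairing function with cubic shells, and let $\phi_f$ be the function on $\mathbb{N}$ defined by $\phi_f(0)=o$ and $\phi_f(f(x,y)+1)=\tau(\phi_f(x),\phi_f(y))$ for all $(x,y)\in\mathbb{N}^2$. Then the sequence $H(\phi_f(0)),\ H(\phi_f(1)),\ H(\phi_f(2)),\ \ldots$ is non-decreasing.
   Context: $\mathbb{N}$ denotes the set of non-negative integers. A pairing function for $\mathbb{N}$ is a bijection $f\colon\mathbb{N}^2\to\mathbb{N}$; it has cubic shells if for all $\mathbf{x},\mathbf{y}\in\mathbb{N}^2$, $\max(\mathbf{x})<\max(\mathbf{y})$ implies $f(\mathbf{x})<f(\mathbf{y})$. Such an $f$ satisfies $\max(x,y)\le f(x,y)$, so the recursion defining $\phi_f$ determines a unique function on $\mathbb{N}$. $o$ denotes the one-vertex binary tree and $\tau(a,b)$ denotes the binary tree with left subtree $a$ and right subtree $b$. The height $H(t)$ of a binary tree $t$ is the length of the longest path from a leaf to the root; thus $H(o)=0$ and $H(\tau(a,b))=1+\max(H(a),H(b))$. *)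

theory Defs
  imports Main "HOL-Library.Tree"
begin

text \<open>Binary trees carry no labels, hence \<^typ>\<open>unit tree\<close>; the one-vertex tree \<open>o\<close> is
  \<^term>\<open>Leaf\<close>, so a leaf counts as a vertex and the library's \<^const>\<open>height\<close> agrees with the length
  of a longest path from a leaf to the root.\<close>

type_synonym binary_tree = "unit tree"

abbreviation tau :: "binary_tree \<Rightarrow> binary_tree \<Rightarrow> binary_tree" where
  "tau a b \<equiv> Node a () b"

definition pairing_function :: "(nat \<times> nat \<Rightarrow> nat) \<Rightarrow> bool" where
  "pairing_function f \<longleftrightarrow> bij f"

definition cubic_shells :: "(nat \<times> nat \<Rightarrow> nat) \<Rightarrow> bool" where
  "cubic_shells f \<longleftrightarrow>
    (\<forall>x1 x2 y1 y2. max x1 x2 < max y1 y2 \<longrightarrow> f (x1, x2) < f (y1, y2))"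

definition phi_recursion :: "(nat \<times> nat \<Rightarrow> nat) \<Rightarrow> (nat \<Rightarrow> binary_tree) \<Rightarrow> bool" where
  "phi_recursion f g \<longleftrightarrow>
    g 0 = Leaf \<and> (\<forall>x y. g (f (x, y) + 1) = tau (g x) (g y))"

text \<open>The description is proper for pairing functions with cubic shells, by \<open>phi_recursion_ex1\<close>
  below; for other \<open>f\<close> the value may be unspecified.\<close>

definition phi :: "(nat \<times> nat \<Rightarrow> nat) \<Rightarrow> nat \<Rightarrow> binary_tree" where
  "phi f = (THE g. phi_recursion f g)"

lemma cubic_shells_max_le:
  assumes "pairing_function f" "cubic_shells f"
  shows "max x y \<le> f (x, y)"
proof -
  let ?m = "max x y"
  have inj: "inj_on f ({..<?m} \<times> {..<?m})"
    using assms(1) by (auto simp: pairing_function_def bij_def intro: inj_on_subset)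
  have sub: "f ` ({..<?m} \<times> {..<?m}) \<subseteq> {..<f (x, y)}"
  proof
    fix n assume "n \<in> f ` ({..<?m} \<times> {..<?m})"
    then obtain a b where ab: "n = f (a, b)" "a < ?m" "b < ?m" by auto
    then have "max a b < ?m" by simp
    then show "n \<in> {..<f (x, y)}"
      using assms(2) ab(1) unfolding cubic_shells_def lessThan_iff by blast
  qed
  have "card (f ` ({..<?m} \<times> {..<?m})) \<le> card {..<f (x, y)}"
    by (rule card_mono[OF _ sub]) simp
  then have "?m * ?m \<le> f (x, y)"
    by (simp only: card_image[OF inj] card_cartesian_product card_lessThan)
  moreover have "?m \<le> ?m * ?m" by (rule le_square)
  ultimately show ?thesis by (rule order_trans[rotated])
qed

lemma phi_recursion_ex1:
  assumes "pairing_function f" "cubic_shells f"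
  shows "\<exists>!g. phi_recursion f g"
proof (rule ex_ex1I)
  define F :: "(nat \<Rightarrow> binary_tree) \<Rightarrow> nat \<Rightarrow> binary_tree" where
    "F = (\<lambda>g n. case n of 0 \<Rightarrow> Leaf
                  | Suc m \<Rightarrow> tau (g (fst (inv f m))) (g (snd (inv f m))))"
  define g where "g = wfrec less_than F"
  have g: "g n = F (cut g less_than n) n" for n
    unfolding g_def by (rule wfrec[OF wf_less_than])
  have inj: "inj f" using assms(1) by (simp add: pairing_function_def bij_def)
  have "g 0 = Leaf" by (subst g) (simp add: F_def)
  moreover have "g (f (x, y) + 1) = tau (g x) (g y)" for x y
    using cubic_shells_max_le[OF assms, of x y]
    by (subst g) (simp add: F_def inv_f_f[OF inj] cut_apply)
  ultimately show "\<exists>g. phi_recursion f g" unfolding phi_recursion_def by blast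
next
  fix g h assume g: "phi_recursion f g" and h: "phi_recursion f h"
  have "g n = h n" for n
  proof (induction n rule: less_induct)
    case (less n)
    show ?case
    proof (cases n)
      case 0
      then show ?thesis using g h by (simp add: phi_recursion_def)
    next
      case (Suc m)
      obtain x y where m: "m = f (x, y)"
        using assms(1) unfolding pairing_function_def by (metis bij_pointE surj_pair)
      have "x < n" "y < n" using cubic_shells_max_le[OF assms, of x y] Suc m by auto
      then have "g x = h x" "g y = h y" using less.IH by auto
      then show ?thesis using g h Suc m by (simp add: phi_recursion_def)
    qed
  qed
  then show "g = h" by blast
qed

end

theory Submission
  imports Defs
begin

text \<open>By strong induction, the height is monotone below \<open>n = f (u, v) + 1\<close>. If \<open>f (x, y) \<le> f (u, v)\<close>,
  cubic shells give \<open>max x y \<le> max u v < n\<close>, so the subtrees coded by \<open>x\<close> and \<open>y\<close> are no higher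
  than the one coded by \<open>max u v\<close>, which is one of the two subtrees coded by \<open>u\<close> and \<open>v\<close>.\<close>

lemma phi_recursion_phi:
  assumes "pairing_function f" "cubic_shells f"
  shows "phi_recursion f (phi f)"
  unfolding phi_def by (rule theI'[OF phi_recursion_ex1[OF assms]])

lemma pairing_functionE:
  assumes "pairing_function f"
  obtains x y where "n = f (x, y)"
  using assms unfolding pairing_function_def by (metis bij_pointE surj_pair)

lemma height_phi_le:
  assumes "pairing_function f" "cubic_shells f" "m \<le> n"
  shows "height (phi f m) \<le> height (phi f n)"
  using assms(3)
\<comment> \<open>\<open>m\<close> stays general because the induction hypothesis at
  \<open>max u v\<close> is used for both \<open>x\<close> and \<open>y\<close>.\<close>
proof (induction n arbitrary: m rule: less_induct)
  case (less n)
  have phi: "phi f 0 = Leaf" "phi f (Suc (f (x, y))) = tau (phi f x) (phi f y)" for x y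
    using phi_recursion_phi[OF assms(1,2)] by (simp_all add: phi_recursion_def)
  show ?case
  proof (cases m)
    case 0
    then show ?thesis by (simp add: phi)
  next
    case (Suc m')
    with less.prems obtain n' where n: "n = Suc n'" by (cases n) auto
    obtain x y where m': "m' = f (x, y)" using assms(1) by (rule pairing_functionE)
    obtain u v where n': "n' = f (u, v)" using assms(1) by (rule pairing_functionE)
    have "f (x, y) \<le> f (u, v)" using less.prems Suc n m' n' by simp
    \<comment> \<open>Contrapositive of the shell condition: \<open>max u v < max x y\<close> would
      force \<open>f (u, v) < f (x, y)\<close>.\<close>
    then have le: "max x y \<le> max u v"
      using assms(2) unfolding cubic_shells_def by (meson not_le)
    \<comment> \<open>The shift by one in the recursion makes the bound
      \<open>max u v \<le> f (u, v)\<close> strict, so the induction hypothesis applies at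
      \<open>max u v\<close>.\<close>
    have "max u v < n" using cubic_shells_max_le[OF assms(1,2), of u v] n n' by simp
    then have "height (phi f x) \<le> height (phi f (max u v))"
        "height (phi f y) \<le> height (phi f (max u v))"
      using less.IH le by auto
    moreover have "height (phi f (max u v)) \<le> max (height (phi f u)) (height (phi f v))"
      by (simp add: max_def)
    ultimately show ?thesis using Suc n m' n' by (simp add: phi)
  qed
qed

theorem theorem9:
  fixes f :: "nat \<times> nat \<Rightarrow> nat"
  assumes "pairing_function f" and "cubic_shells f"
  shows "mono (\<lambda>n. height (phi f n))"
  using height_phi_le[OF assms] by (rule monoI)

end
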